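(* Let $Y$ be a metric space, $Z$ a normed linear space and $f\colon Y\to Z$ a Baire one function. Then there is a sequence $\{f_n\}_{n\in\mathbb N}$ of bounded locally Lipschitz functions $f_n\colon Y\to Z$ converging pointwise to $f$ on $Y$, such that $\{f_n\}$ has UCPC and such that $\{f_n\}$ is uniformly bounded on $B_Y(a,r)$ (that is, $\sup_{n\in\mathbb N}\sup_{y\in B_Y(a,r)}\|f_n(y)\|_Z<\infty$) whenever $a\in Y$, $r\in(0,\infty)\cup\{\infty\}$ and $f$ is bounded on $B_Y(a,2r)$.
   Context: A function $f\colon Y\to Z$ is Baire one if it is the pointwise limit of a sequence of continuous functions $Y\to Z$. UCPC (uniform convergence at points of continuity): for arbitrary functions $h_n\colon Y\to Z$ ($n\in\mathbb N$) and $f\colon Y\to Z$, the pair $(\{h_n\},f)$ has UCPC if for every $y_0\in Y$ at which $f$ is continuous and every $\varepsilon>0$ there are $k_0\in\mathbb N$ and a neighborhood $U$ of $y_0$ such that $\|h_k(y)-f(y_0)\|_Z<\varepsilon$ for every $k\ge k_0$ and every $y\in U$. If $h_n\to f$ pointwise on $Y$, the sequence $\{h_n\}$ is said to have UCPC if the pair $(\{h_n\},f)$ has UCPC. A function on $Y$ is locally Lipschitz if every point of $Y$ has a neighborhood on which the function is Lipschitz. $B_Y(a,r)$ is the open ball in $Y$ with center $a$ and radius $r$; $B_Y(a,\infty)=Y$, and $2r=\infty$ if $r=\infty$. $Z$ is not assumed complete. *)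

theory Defs
  imports "HOL-Analysis.Analysis"
begin

definition baire_one :: "('a::topological_space \<Rightarrow> 'b::topological_space) \<Rightarrow> bool" where
  "baire_one f \<longleftrightarrow>
    (\<exists>g :: nat \<Rightarrow> 'a \<Rightarrow> 'b. (\<forall>n. continuous_on UNIV (g n)) \<and> (\<forall>y. (\<lambda>n. g n y) \<longlonglongrightarrow> f y))"

text \<open>Uniform convergence at points of continuity, for a pair of a sequence and a function;
  no pointwise convergence is presupposed.\<close>

definition UCPC :: "(nat \<Rightarrow> 'a::metric_space \<Rightarrow> 'b::real_normed_vector) \<Rightarrow> ('a \<Rightarrow> 'b) \<Rightarrow> bool" where
  "UCPC h f \<longleftrightarrow>
    (\<forall>y0. isCont f y0 \<longrightarrow>
      (\<forall>\<epsilon>>0. \<exists>k0 U. open U \<and> y0 \<in> U \<and> (\<forall>k\<ge>k0. \<forall>y\<in>U. norm (h k y - f y0) < \<epsilon>)))"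

text \<open>The library's \<open>local_lipschitz\<close> is about parametrised families and asks for
  compatibility with the parameter; this is the plain notion for a single function.\<close>

definition locally_lipschitz :: "('a::metric_space \<Rightarrow> 'b::metric_space) \<Rightarrow> bool" where
  "locally_lipschitz f \<longleftrightarrow> (\<forall>y. \<exists>U L. open U \<and> y \<in> U \<and> L-lipschitz_on U f)"

text \<open>The supremum is taken in \<open>ereal\<close>, so that it is genuinely \<open>\<infinity>\<close> for unbounded families.\<close>

definition uniformly_bounded_on :: "'a set \<Rightarrow> (nat \<Rightarrow> 'a \<Rightarrow> 'b::real_normed_vector) \<Rightarrow> bool" where
  "uniformly_bounded_on B h \<longleftrightarrow> (SUP n. SUP y\<in>B. ereal (norm (h n y))) < \<infinity>"

end

theory Submission
  imports Defs
begin

text \<open>Up to a final truncation, the approximants are built so that \<open>F n y\<close> is a convex combination of values that \<open>f\<close> itself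
  takes on the ball of radius \<open>1 / (n + 1)\<close> around \<open>y\<close>. This single property yields both UCPC (near a
  point of continuity all these values are close to the value at that point) and the uniform bounds
  (for \<open>y\<close> within \<open>r\<close> of \<open>a\<close> and \<open>1 / (n + 1) \<le> r\<close> the values are taken within \<open>2 r\<close> of \<open>a\<close>; the
  finitely many remaining \<open>n\<close> are harmless once each \<open>F n\<close> is bounded). Boundedness of each \<open>F n\<close> is
  forced at the end by a Lipschitz cutoff of large values, which changes nothing where \<open>F n\<close> has
  norm at most \<open>n\<close>.

  Pointwise convergence decides which values to combine. Let \<open>g n\<close> be continuous with pointwise limit
  \<open>f\<close>. The sets \<open>A m k\<close> of those \<open>y\<close> for which all \<open>g j y\<close> with \<open>j \<ge> m\<close> stay within \<open>1 / (k + 1)\<close> of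
  \<open>g m y\<close> are closed, every point lies in some \<open>A m k\<close> for each \<open>k\<close>, and on \<open>A m k\<close> the function \<open>f\<close>
  is within \<open>2 / (k + 1)\<close> of every \<open>g n\<close> with \<open>n \<ge> m\<close>. At stage \<open>n\<close> the value \<open>f y\<close> may be used only on
  a small neighbourhood of \<open>y\<close> that avoids each \<open>A m k\<close> with \<open>m, k \<le> n\<close> not containing \<open>y\<close>. Hence at a
  point \<open>x\<close> of \<open>A m k\<close> only values \<open>f y\<close> with \<open>y\<close> in \<open>A m k\<close> enter, and these are all close to \<open>g n x\<close>.
  So \<open>F n x\<close> is close to \<open>g n x\<close>, which tends to \<open>f x\<close>. This is
  \<open>baire_one_hull_approximation\<close>.

  What remains is to combine prescribed values over an arbitrary open cover of a metric space in
  a locally Lipschitz way, \<open>locally_lipschitz_convex_selection\<close>. As in the proof that metric spaces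
  are paracompact, a well-order of the index set splits the space into countably many layers in
  each of which points assigned to different indices are uniformly separated; the
  layers are then merged one after the other.\<close>

section \<open>Locally Lipschitz functions\<close>

lemma lipschitz_imp_locally_lipschitz:
  assumes "L-lipschitz_on UNIV f"
  shows "locally_lipschitz f"
  unfolding locally_lipschitz_def using assms open_UNIV by blast

lemma locally_lipschitz_const: "locally_lipschitz (\<lambda>_. c)"
  by (rule lipschitz_imp_locally_lipschitz[OF lipschitz_on_constant])

lemma locally_lipschitz_if_locally_equal:
  assumes "\<And>y. \<exists>V h. open V \<and> y \<in> V \<and> locally_lipschitz h \<and> (\<forall>z\<in>V. f z = h z)"
  shows "locally_lipschitz f"
  unfolding locally_lipschitz_def
proof
  fix y
  obtain V h where V: "open V" "y \<in> V" "locally_lipschitz h" "\<And>z. z \<in> V \<Longrightarrow> f z = h z"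
    using assms by metis
  obtain U L where U: "open U" "y \<in> U" "L-lipschitz_on U h"
    using V(3) unfolding locally_lipschitz_def by metis
  have "L-lipschitz_on (U \<inter> V) h"
    by (rule lipschitz_on_subset[OF U(3)]) auto
  then have "L-lipschitz_on (U \<inter> V) f"
    by (rule lipschitz_on_transform) (simp add: V)
  then show "\<exists>U L. open U \<and> y \<in> U \<and> L-lipschitz_on U f"
    using U V by (meson IntI open_Int)
qed

lemma locally_lipschitz_continuous:
  assumes "locally_lipschitz f"
  shows "continuous_on UNIV f"
proof (rule continuous_at_imp_continuous_on, rule ballI)
  fix y
  obtain U L where U: "open U" "y \<in> U" "L-lipschitz_on U f"
    using assms unfolding locally_lipschitz_def by metis
  show "isCont f y"
    using lipschitz_on_continuous_on[OF U(3)] U(1,2) by (simp add: continuous_on_eq_continuous_at)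
qed

lemma locally_lipschitz_compose:
  assumes "locally_lipschitz g" "locally_lipschitz f"
  shows "locally_lipschitz (\<lambda>x. g (f x))"
  unfolding locally_lipschitz_def
proof
  fix y
  obtain U L where U: "open U" "y \<in> U" "L-lipschitz_on U f"
    using assms(2) unfolding locally_lipschitz_def by metis
  obtain V M where V: "open V" "f y \<in> V" "M-lipschitz_on V g"
    using assms(1) unfolding locally_lipschitz_def by metis
  have op: "open (f -` V)"
    using locally_lipschitz_continuous[OF assms(2)] V(1)
    by (simp add: continuous_on_open_vimage)
  have "L-lipschitz_on (U \<inter> f -` V) f"
    by (rule lipschitz_on_subset[OF U(3)]) auto
  moreover have "M-lipschitz_on (f ` (U \<inter> f -` V)) g"
    by (rule lipschitz_on_subset[OF V(3)]) auto
  ultimately have "(M * L)-lipschitz_on (U \<inter> f -` V) (\<lambda>x. g (f x))"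
    by (rule lipschitz_on_compose2)
  then show "\<exists>U L. open U \<and> y \<in> U \<and> L-lipschitz_on U (\<lambda>x. g (f x))"
    using U V op by (intro exI[of _ "U \<inter> f -` V"]) auto
qed

lemma locally_lipschitz_add:
  fixes f g :: "'a::metric_space \<Rightarrow> 'b::real_normed_vector"
  assumes "locally_lipschitz f" "locally_lipschitz g"
  shows "locally_lipschitz (\<lambda>x. f x + g x)"
  unfolding locally_lipschitz_def
proof
  fix y
  obtain U L where U: "open U" "y \<in> U" "L-lipschitz_on U f"
    using assms(1) unfolding locally_lipschitz_def by metis
  obtain V M where V: "open V" "y \<in> V" "M-lipschitz_on V g"
    using assms(2) unfolding locally_lipschitz_def by metis
  have "(L + M)-lipschitz_on (U \<inter> V) (\<lambda>x. f x + g x)"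
    using U(3) V(3) by (intro lipschitz_on_add) (auto elim: lipschitz_on_subset)
  then show "\<exists>U L. open U \<and> y \<in> U \<and> L-lipschitz_on U (\<lambda>x. f x + g x)"
    using U V by (meson IntI open_Int)
qed

lemma locally_lipschitz_scaleR:
  fixes f :: "'a::metric_space \<Rightarrow> real" and g :: "'a \<Rightarrow> 'b::real_normed_vector"
  assumes "locally_lipschitz f" "locally_lipschitz g"
  shows "locally_lipschitz (\<lambda>x. f x *\<^sub>R g x)"
  unfolding locally_lipschitz_def
proof
  fix y
  obtain U L where U: "open U" "y \<in> U" "L-lipschitz_on U f"
    using assms(1) unfolding locally_lipschitz_def by metis
  obtain V M where V: "open V" "y \<in> V" "M-lipschitz_on V g"
    using assms(2) unfolding locally_lipschitz_def by metis
  let ?W = "U \<inter> V \<inter> ball y 1"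
  define A where "A = \<bar>f y\<bar> + L"
  define B where "B = norm (g y) + M"
  have L0: "L \<ge> 0" and M0: "M \<ge> 0"
    using U(3) V(3) by (auto dest: lipschitz_on_nonneg)
  have fb: "\<bar>f z\<bar> \<le> A" if "z \<in> ?W" for z
  proof -
    have "dist (f z) (f y) \<le> L * dist z y"
      using lipschitz_onD[OF U(3)] that U(2) by simp
    also have "\<dots> \<le> L * 1"
      using that L0 by (intro mult_left_mono) (auto simp: dist_commute)
    finally show ?thesis unfolding A_def dist_real_def by linarith
  qed
  have gb: "norm (g z) \<le> B" if "z \<in> ?W" for z
  proof -
    have "dist (g z) (g y) \<le> M * dist z y"
      using lipschitz_onD[OF V(3)] that V(2) by simp
    also have "\<dots> \<le> M * 1"
      using that M0 by (intro mult_left_mono) (auto simp: dist_commute)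
    finally show ?thesis
      unfolding B_def dist_norm using norm_triangle_ineq2[of "g z" "g y"] by linarith
  qed
  have "(A * M + L * B)-lipschitz_on ?W (\<lambda>x. f x *\<^sub>R g x)"
  proof (rule lipschitz_onI)
    have "A \<ge> 0" "B \<ge> 0" unfolding A_def B_def using L0 M0 by auto
    then show "0 \<le> A * M + L * B" using L0 M0 by simp
    fix u v assume u: "u \<in> ?W" and v: "v \<in> ?W"
    have eq: "f u *\<^sub>R g u - f v *\<^sub>R g v = f u *\<^sub>R (g u - g v) + (f u - f v) *\<^sub>R g v"
      by (simp add: algebra_simps)
    have "norm (f u *\<^sub>R (g u - g v)) \<le> A * (M * dist u v)"
      using fb[OF u] lipschitz_onD[OF V(3), of u v] u v \<open>A \<ge> 0\<close>
      by (auto simp: dist_norm intro!: mult_mono)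
    moreover have "norm ((f u - f v) *\<^sub>R g v) \<le> (L * dist u v) * B"
      using gb[OF v] lipschitz_onD[OF U(3), of u v] u v L0
      by (auto simp: dist_real_def intro!: mult_mono)
    ultimately have "norm (f u *\<^sub>R g u - f v *\<^sub>R g v) \<le> A * (M * dist u v) + (L * dist u v) * B"
      unfolding eq by (rule norm_triangle_mono)
    then show "dist (f u *\<^sub>R g u) (f v *\<^sub>R g v) \<le> (A * M + L * B) * dist u v"
      by (simp add: dist_norm algebra_simps)
  qed
  moreover have "open ?W" "y \<in> ?W" using U V by auto
  ultimately show "\<exists>U L. open U \<and> y \<in> U \<and> L-lipschitz_on U (\<lambda>x. f x *\<^sub>R g x)"
    by blast
qed

text \<open>The last two properties speak of points of \<open>E\<close> instead of the distance to \<open>E\<close>, because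
  \<^term>\<open>infdist x E\<close> is \<open>0\<close> for empty \<open>E\<close>, where \<open>\<psi>\<close> has to vanish.\<close>

lemma lipschitz_cutoff:
  fixes E :: "'a::metric_space set"
  assumes "\<epsilon> > 0"
  obtains \<psi> :: "'a \<Rightarrow> real" where
    "locally_lipschitz \<psi>" "\<And>x. 0 \<le> \<psi> x" "\<And>x. \<psi> x \<le> 1"
    "\<And>x e. e \<in> E \<Longrightarrow> dist x e < \<epsilon> / 2 \<Longrightarrow> \<psi> x = 1"
    "\<And>x. \<psi> x \<noteq> 0 \<Longrightarrow> \<exists>e\<in>E. dist x e < \<epsilon>"
proof (cases "E = {}")
  case True
  then show thesis
    using that[of "\<lambda>_. 0"] locally_lipschitz_const by auto
next
  case False
  define \<psi> where "\<psi> x = max 0 (min 1 (2 - 2 / \<epsilon> * infdist x E))" for x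
  have "(2 / \<epsilon>)-lipschitz_on UNIV \<psi>"
  proof (rule lipschitz_onI)
    fix x y
    have "\<bar>\<psi> x - \<psi> y\<bar> \<le> \<bar>2 / \<epsilon> * infdist x E - 2 / \<epsilon> * infdist y E\<bar>"
      unfolding \<psi>_def by linarith
    also have "\<dots> = 2 / \<epsilon> * \<bar>infdist x E - infdist y E\<bar>"
      using assms by (simp only: abs_mult flip: right_diff_distrib) simp
    also have "\<dots> \<le> 2 / \<epsilon> * dist x y"
      using infdist_triangle_abs[of x E y] assms by (intro mult_left_mono) auto
    finally show "dist (\<psi> x) (\<psi> y) \<le> 2 / \<epsilon> * dist x y" by (simp add: dist_real_def)
  qed (use assms in auto)
  moreover have "\<psi> x = 1" if "e \<in> E" "dist x e < \<epsilon> / 2" for x e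
  proof -
    have "infdist x E < \<epsilon> / 2" using infdist_le[OF that(1), of x] that(2) by simp
    then have "2 / \<epsilon> * infdist x E < 1" using assms by (simp add: field_simps)
    then show ?thesis unfolding \<psi>_def by simp
  qed
  moreover have "\<exists>e\<in>E. dist x e < \<epsilon>" if "\<psi> x \<noteq> 0" for x
  proof -
    have "2 / \<epsilon> * infdist x E < 2" using that unfolding \<psi>_def by linarith
    then have "infdist x E < \<epsilon>" using assms by (simp add: field_simps)
    then show ?thesis
      using False by (auto simp: infdist_notempty cINF_less_iff)
  qed
  ultimately show thesis
    by (intro that[of \<psi>]) (auto intro: lipschitz_imp_locally_lipschitz simp: \<psi>_def)
qed

section \<open>Locally Lipschitz selections from convex hulls\<close>

text \<open>Let \<open>a x\<close> be the least index, in some well-order, whose set contains \<open>x\<close>. If \<open>a x\<close> precedes \<open>a y\<close>,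
  then \<open>y\<close> cannot lie in \<open>U (a x)\<close>. Stated symmetrically, this makes the order disappear from
  the rest of the construction.\<close>

lemma separated_choice_from_cover:
  fixes U :: "'i \<Rightarrow> 'a set"
  assumes "\<And>x. \<exists>i. x \<in> U i"
  obtains a where "\<And>x. x \<in> U (a x)"
    "\<And>x y. a x \<noteq> a y \<Longrightarrow> x \<notin> U (a y) \<or> y \<notin> U (a x)"
proof -
  obtain r :: "'i rel" where r: "well_order_on UNIV r"
    using well_order_on by blast
  then have wf: "wf (r - Id)" and tot: "total r"
    by (auto simp: well_order_on_def linear_order_on_def)
  have "\<exists>i. x \<in> U i \<and> (\<forall>j. (j, i) \<in> r - Id \<longrightarrow> x \<notin> U j)" for x
  proof -
    obtain i where "i \<in> {i. x \<in> U i}" "\<And>j. (j, i) \<in> r - Id \<Longrightarrow> j \<notin> {i. x \<in> U i}"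
      using wfE_min'[OF wf, of "{i. x \<in> U i}"] assms[of x] by (metis empty_iff mem_Collect_eq)
    then show ?thesis by (intro exI[of _ i]) simp
  qed
  then obtain a where a: "\<And>x. x \<in> U (a x)"
      "\<And>x j. (j, a x) \<in> r - Id \<Longrightarrow> x \<notin> U j"
    by metis
  have "x \<notin> U (a y) \<or> y \<notin> U (a x)" if "a x \<noteq> a y" for x y
    using tot that a(2)[of "a x" y] a(2)[of "a y" x] by (auto simp: total_on_def)
  with a(1) show thesis by (rule that)
qed

text \<open>The layer \<open>E\<close> consists of the points \<open>x\<close> that lie at depth at least \<open>\<epsilon>\<close> in their set \<open>U (a x)\<close>. Two points
  of \<open>E\<close> at distance less than \<open>\<epsilon>\<close> lie in each other's sets, so the separation property gives them
  the same index. Hence \<open>x \<mapsto> c (a x)\<close> extends to a locally constant function on a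
  neighbourhood of \<open>E\<close>, and \<open>\<psi>\<close> cuts it off within this neighbourhood.\<close>

lemma locally_lipschitz_layer:
  fixes U :: "'i \<Rightarrow> 'a::metric_space set" and c :: "'i \<Rightarrow> 'b::real_normed_vector"
  assumes sep: "\<And>x y. a x \<noteq> a y \<Longrightarrow> x \<notin> U (a y) \<or> y \<notin> U (a x)" and "\<epsilon> > 0"
  shows "\<exists>(\<psi> :: 'a \<Rightarrow> real) v. locally_lipschitz \<psi> \<and> locally_lipschitz (\<lambda>x. \<psi> x *\<^sub>R v x) \<and>
    (\<forall>x. 0 \<le> \<psi> x \<and> \<psi> x \<le> 1) \<and>
    (\<forall>x. ball x \<epsilon> \<subseteq> U (a x) \<longrightarrow> (\<exists>V. open V \<and> x \<in> V \<and> (\<forall>y\<in>V. \<psi> y = 1))) \<and>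
    (\<forall>x. \<psi> x \<noteq> 0 \<longrightarrow> (\<exists>i. x \<in> U i \<and> v x = c i))"
proof -
  define E where "E = {x. ball x \<epsilon> \<subseteq> U (a x)}"
  have same: "a e = a e'" if "e \<in> E" "e' \<in> E" "dist e e' < \<epsilon>" for e e'
    using that sep[of e e'] unfolding E_def by (auto simp: subset_iff dist_commute)
  obtain \<psi> :: "'a \<Rightarrow> real" where \<psi>: "locally_lipschitz \<psi>" "\<And>x. 0 \<le> \<psi> x" "\<And>x. \<psi> x \<le> 1"
    "\<And>x e. e \<in> E \<Longrightarrow> dist x e < \<epsilon> / 4 / 2 \<Longrightarrow> \<psi> x = 1"
    "\<And>x. \<psi> x \<noteq> 0 \<Longrightarrow> \<exists>e\<in>E. dist x e < \<epsilon> / 4"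
    using lipschitz_cutoff[of "\<epsilon> / 4" E] \<open>\<epsilon> > 0\<close> by auto
  obtain p where p: "\<And>x. \<psi> x \<noteq> 0 \<Longrightarrow> p x \<in> E \<and> dist x (p x) < \<epsilon> / 4"
    using \<psi>(5) by metis
  define v where "v x = c (a (p x))" for x
  have "locally_lipschitz (\<lambda>x. \<psi> x *\<^sub>R v x)"
  proof (rule locally_lipschitz_if_locally_equal)
    fix x
    have "\<exists>w. \<forall>y\<in>ball x (\<epsilon> / 8). \<psi> y \<noteq> 0 \<longrightarrow> v y = w"
    proof (cases "\<exists>z\<in>ball x (\<epsilon> / 8). \<psi> z \<noteq> 0")
      case True
      then obtain z where z: "dist x z < \<epsilon> / 8" "\<psi> z \<noteq> 0" by auto
      have "v y = v z" if y: "dist x y < \<epsilon> / 8" "\<psi> y \<noteq> 0" for y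
      proof -
        have "dist (p y) (p z) < \<epsilon>"
          using p[OF y(2)] p[OF z(2)] y(1) z(1) \<open>\<epsilon> > 0\<close>
            dist_triangle[of "p y" "p z" y] dist_triangle[of y "p z" z] dist_triangle[of y z x]
          by (simp add: dist_commute)
        then show ?thesis
          unfolding v_def using same[of "p y" "p z"] p[OF y(2)] p[OF z(2)] by simp
      qed
      then show ?thesis by auto
    qed auto
    then obtain w where w: "\<forall>y\<in>ball x (\<epsilon> / 8). \<psi> y *\<^sub>R v y = \<psi> y *\<^sub>R w" by (metis scaleR_zero_left)
    have "locally_lipschitz (\<lambda>y. \<psi> y *\<^sub>R w)"
      by (intro locally_lipschitz_scaleR \<psi>(1) locally_lipschitz_const)
    then show "\<exists>V h. open V \<and> x \<in> V \<and> locally_lipschitz h \<and> (\<forall>z\<in>V. \<psi> z *\<^sub>R v z = h z)"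
      using w \<open>\<epsilon> > 0\<close> by (intro exI[of _ "ball x (\<epsilon> / 8)"] exI[of _ "\<lambda>y. \<psi> y *\<^sub>R w"]) auto
  qed
  moreover have "\<exists>V. open V \<and> x \<in> V \<and> (\<forall>y\<in>V. \<psi> y = 1)" if "ball x \<epsilon> \<subseteq> U (a x)" for x
    using that \<psi>(4)[of x] \<open>\<epsilon> > 0\<close> unfolding E_def
    by (intro exI[of _ "ball x (\<epsilon> / 8)"]) (auto simp: dist_commute)
  moreover have "\<exists>i. x \<in> U i \<and> v x = c i" if "\<psi> x \<noteq> 0" for x
  proof -
    have "x \<in> ball (p x) \<epsilon>" using p[OF that] \<open>\<epsilon> > 0\<close> by (auto simp: dist_commute)
    then have "x \<in> U (a (p x))" using p[OF that] unfolding E_def by blast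
    then show ?thesis unfolding v_def by blast
  qed
  ultimately show ?thesis using \<psi>(1,2,3) by blast
qed

text \<open>Layer \<open>n\<close> receives the share \<open>\<psi> n\<close> of the mass \<open>P n\<close> that the previous layers have left over.
  Every point is in the interior of \<open>{\<psi> n = 1}\<close> for some \<open>n\<close>, so near it no mass is left after
  stage \<open>n\<close> and the partial sums are locally stationary. Thus the infinite sum needs neither
  normalisation nor a locally finite refinement of the cover.\<close>

lemma locally_lipschitz_convex_selection:
  fixes U :: "'i \<Rightarrow> 'a::metric_space set" and c :: "'i \<Rightarrow> 'b::real_normed_vector"
  assumes op: "\<And>i. open (U i)" and cover: "\<And>x. \<exists>i. x \<in> U i"
  obtains G where "locally_lipschitz G" "\<And>x. G x \<in> convex hull (c ` {i. x \<in> U i})"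
proof -
  obtain a where a: "\<And>x. x \<in> U (a x)" "\<And>x y. a x \<noteq> a y \<Longrightarrow> x \<notin> U (a y) \<or> y \<notin> U (a x)"
    using separated_choice_from_cover[of U] cover by metis
  define layer where "layer n \<psi> v \<longleftrightarrow>
    locally_lipschitz \<psi> \<and> locally_lipschitz (\<lambda>x. \<psi> x *\<^sub>R v x) \<and>
    (\<forall>x. 0 \<le> \<psi> x \<and> \<psi> x \<le> 1) \<and>
    (\<forall>x. ball x (inverse (real (Suc n))) \<subseteq> U (a x) \<longrightarrow> (\<exists>V. open V \<and> x \<in> V \<and> (\<forall>y\<in>V. \<psi> y = 1))) \<and>
    (\<forall>x. \<psi> x \<noteq> 0 \<longrightarrow> (\<exists>i. x \<in> U i \<and> v x = c i))" for n and \<psi> :: "'a \<Rightarrow> real" and v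
  have "\<exists>\<psi> v. layer n \<psi> v" for n
    unfolding layer_def by (rule locally_lipschitz_layer[of a U _ c, OF a(2)]) simp_all
  then obtain \<psi> v where layer: "\<And>n. layer n (\<psi> n) (v n)"
    by metis
  have lip: "locally_lipschitz (\<psi> n)" "locally_lipschitz (\<lambda>x. \<psi> n x *\<^sub>R v n x)"
    and range: "0 \<le> \<psi> n x" "\<psi> n x \<le> 1"
    and one: "ball x (inverse (real (Suc n))) \<subseteq> U (a x) \<Longrightarrow> \<exists>V. open V \<and> x \<in> V \<and> (\<forall>y\<in>V. \<psi> n y = 1)"
    and val: "\<psi> n x \<noteq> 0 \<Longrightarrow> \<exists>i. x \<in> U i \<and> v n x = c i" for n x
    using layer[of n] unfolding layer_def by blast+
  define P where "P N x = (\<Prod>j<N. 1 - \<psi> j x)" for N x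
  define H where "H N x = (\<Sum>n<N. P n x *\<^sub>R \<psi> n x *\<^sub>R v n x)" for N x
  have P_lip: "locally_lipschitz (P N)" for N
  proof (induction N)
    case 0
    show ?case unfolding P_def using locally_lipschitz_const by simp
  next
    case (Suc N)
    have "locally_lipschitz (\<lambda>x. P N x *\<^sub>R (1 + (- 1) *\<^sub>R \<psi> N x))"
      by (intro locally_lipschitz_scaleR locally_lipschitz_add locally_lipschitz_const lip Suc)
    then show ?case unfolding P_def by simp
  qed
  have H_lip: "locally_lipschitz (H N)" for N
  proof (induction N)
    case 0
    show ?case unfolding H_def using locally_lipschitz_const by simp
  next
    case (Suc N)
    have "locally_lipschitz (\<lambda>x. H N x + P N x *\<^sub>R \<psi> N x *\<^sub>R v N x)"
      by (intro locally_lipschitz_add locally_lipschitz_scaleR Suc P_lip lip)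
    then show ?case unfolding H_def by simp
  qed
  \<comment> \<open>Handing the leftover mass to any point of \<open>K\<close> gives a full convex combination; this form of the
    claim survives the induction step, since layer \<open>N\<close> splits that point into two.\<close>
  have mass: "H N x + P N x *\<^sub>R k \<in> K"
    if K: "convex K" "c ` {i. x \<in> U i} \<subseteq> K" and "k \<in> K" for N x k and K :: "'b set"
    using \<open>k \<in> K\<close>
  proof (induction N arbitrary: k)
    case 0
    then show ?case by (simp add: H_def P_def)
  next
    case (Suc N)
    have "\<psi> N x *\<^sub>R v N x + (1 - \<psi> N x) *\<^sub>R k \<in> K"
    proof (cases "\<psi> N x = 0")
      case True
      then show ?thesis using Suc.prems by simp
    next
      case False
      then have "v N x \<in> K" using val[OF False] K(2) by auto
      then show ?thesis using convexD[OF K(1)] range Suc.prems by simp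
    qed
    from Suc.IH[OF this] show ?case
      by (simp add: H_def P_def algebra_simps)
  qed
  have stationary: "H N x = H M x" if "P M x = 0" "M \<le> N" for M N x
    using that(2)
  proof (induction N rule: dec_induct)
    case (step N)
    have "P N x = 0"
      using that(1) step.hyps(1) unfolding P_def by (auto intro: less_le_trans)
    then show ?case using step.IH by (simp add: H_def)
  qed simp
  have ex: "\<exists>V N. open V \<and> x \<in> V \<and> (\<forall>y\<in>V. P N y = 0)" for x
  proof -
    obtain e where e: "e > 0" "ball x e \<subseteq> U (a x)"
      using op a(1) open_contains_ball by metis
    obtain n where "inverse (real (Suc n)) < e"
      using reals_Archimedean[OF e(1)] by auto
    then have "ball x (inverse (real (Suc n))) \<subseteq> U (a x)" using e(2) by (meson less_imp_le subset_ball subset_trans)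
    then obtain V where "open V" "x \<in> V" "\<forall>y\<in>V. \<psi> n y = 1" using one by blast
    then show ?thesis by (intro exI[of _ V] exI[of _ "Suc n"]) (simp add: P_def)
  qed
  then obtain \<nu> where \<nu>: "\<And>x. P (\<nu> x) x = 0" by metis
  \<comment> \<open>\<open>\<nu>\<close> is an arbitrary choice with no regularity; by stationarity any admissible index
    gives the same value, so on the neighbourhoods above a constant index can be used.\<close>
  define G where "G x = H (\<nu> x) x" for x
  have G_eq: "G x = H N x" if "P N x = 0" for x N
    unfolding G_def using stationary[OF that, of "\<nu> x"] stationary[OF \<nu>[of x], of N]
    by (metis linear)
  show thesis
  proof (rule that)
    show "locally_lipschitz G"
    proof (rule locally_lipschitz_if_locally_equal)
      fix x
      obtain V N where "open V" "x \<in> V" "\<forall>y\<in>V. P N y = 0" using ex by blast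
      then show "\<exists>V h. open V \<and> x \<in> V \<and> locally_lipschitz h \<and> (\<forall>z\<in>V. G z = h z)"
        using H_lip[of N] G_eq[of N] by blast
    qed
    fix x
    have "c (a x) \<in> convex hull (c ` {i. x \<in> U i})"
      using a(1) by (intro hull_inc) auto
    from mass[OF convex_convex_hull hull_subset this, of "\<nu> x"]
    show "G x \<in> convex hull (c ` {i. x \<in> U i})"
      by (simp add: G_def \<nu>)
  qed
qed

section \<open>Approximation of Baire one functions\<close>

text \<open>The hull condition controls \<open>G n\<close> by nearby values of \<open>f\<close> alone, without reference to the
  continuous functions that converge to \<open>f\<close>; these may be wild where \<open>f\<close> is bounded or continuous.\<close>

lemma baire_one_hull_approximation:
  fixes f :: "'a::metric_space \<Rightarrow> 'b::real_normed_vector"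
  assumes "baire_one f"
  obtains G where "\<And>n. locally_lipschitz (G n)" "\<And>y. (\<lambda>n. G n y) \<longlonglongrightarrow> f y"
    "\<And>n y. G n y \<in> convex hull (f ` ball y (inverse (Suc n)))"
proof -
  obtain g :: "nat \<Rightarrow> 'a \<Rightarrow> 'b" where g: "\<And>n. continuous_on UNIV (g n)" "\<And>y. (\<lambda>n. g n y) \<longlonglongrightarrow> f y"
    using assms unfolding baire_one_def by blast
  define A where "A m k = {y. \<forall>j\<ge>m. dist (g j y) (g m y) \<le> inverse (Suc k)}" for m k
  have A_closed: "closed (A m k)" for m k
    unfolding A_def by (intro closed_Collect_all closed_Collect_imp open_Collect_const
        closed_Collect_le continuous_intros g(1))
  have A_near: "dist (g n y) (f y) \<le> 2 * inverse (Suc k)" if "y \<in> A m k" "m \<le> n" for n m k y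
  proof -
    have "(\<lambda>j. dist (g j y) (g m y)) \<longlonglongrightarrow> dist (f y) (g m y)"
      by (intro tendsto_intros g(2))
    moreover have "\<exists>N. \<forall>j\<ge>N. dist (g j y) (g m y) \<le> inverse (Suc k)"
      using that(1) unfolding A_def by auto
    ultimately have "dist (f y) (g m y) \<le> inverse (Suc k)"
      by (rule LIMSEQ_le_const2)
    moreover have "dist (g n y) (g m y) \<le> inverse (Suc k)"
      using that unfolding A_def by auto
    ultimately show ?thesis
      using dist_triangle2[of "g n y" "f y" "g m y"] by linarith
  qed
  \<comment> \<open>Only the finitely many \<open>A m k\<close> with \<open>m, k \<le> n\<close> are removed, which keeps \<open>U n y\<close> open. For a
    fixed point and accuracy a single pair \<open>(m, k)\<close> matters, and it is included from some stage on.\<close>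
  define U where "U n y = ball y (inverse (Suc n)) \<inter> {x. dist (g n x) (g n y) < inverse (Suc n)}
      \<inter> - (\<Union>(m, k) \<in> {(m, k). m \<le> n \<and> k \<le> n \<and> y \<notin> A m k}. A m k)" for n y
  have U_open: "open (U n y)" for n y
  proof -
    have "finite {(m, k). m \<le> n \<and> k \<le> n \<and> y \<notin> A m k}"
      by (rule finite_subset[of _ "{..n} \<times> {..n}"]) auto
    then have "closed (\<Union>(m, k) \<in> {(m, k). m \<le> n \<and> k \<le> n \<and> y \<notin> A m k}. A m k)"
      by (rule closed_UN) (use A_closed in auto)
    moreover have "open {x. dist (g n x) (g n y) < inverse (Suc n)}"
      by (intro open_Collect_less continuous_intros g(1))
    ultimately show ?thesis unfolding U_def
      by (intro open_Int open_ball open_Compl)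
  qed
  have U_self: "y \<in> U n y" for n y unfolding U_def by auto
  have "\<exists>G. locally_lipschitz G \<and> (\<forall>x. G x \<in> convex hull (f ` {y. x \<in> U n y}))" for n
    using locally_lipschitz_convex_selection[of "U n" f] U_open U_self by metis
  then obtain G where G: "\<And>n. locally_lipschitz (G n)"
      "\<And>n x. G n x \<in> convex hull (f ` {y. x \<in> U n y})"
    by metis
  show thesis
  proof (rule that)
    show "locally_lipschitz (G n)" for n by (rule G)
    show "G n x \<in> convex hull (f ` ball x (inverse (Suc n)))" for n x
    proof -
      have "f ` {y. x \<in> U n y} \<subseteq> f ` ball x (inverse (Suc n))"
        unfolding U_def by (auto simp: dist_commute)
      then show ?thesis using G(2)[of n x] hull_mono by blast
    qed
    fix x
    have "(\<lambda>n. dist (G n x) (g n x)) \<longlonglongrightarrow> 0"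
    proof (rule LIMSEQ_I)
      fix e :: real assume "e > 0"
      then obtain k where k: "inverse (real (Suc k)) < e / 3"
        using reals_Archimedean[of "e / 3"] by auto
      have "Cauchy (\<lambda>n. g n x)" using g(2) by (rule LIMSEQ_imp_Cauchy)
      then obtain m where "\<forall>i\<ge>m. \<forall>j\<ge>m. dist (g i x) (g j x) < inverse (Suc k)"
        unfolding Cauchy_def by (metis inverse_positive_iff_positive of_nat_0_less_iff zero_less_Suc)
      then have xA: "x \<in> A m k" unfolding A_def by (auto intro: less_imp_le)
      have "norm (dist (G n x) (g n x) - 0) < e" if n: "n \<ge> max m k" for n
      proof -
        have "f y \<in> cball (g n x) (3 * inverse (Suc k))" if "x \<in> U n y" for y
        proof -
          \<comment> \<open>Otherwise \<open>A m k\<close>, which contains \<open>x\<close>, would have been removed from \<open>U n y\<close>.\<close>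
          have "y \<in> A m k" using that n xA unfolding U_def by auto
          then have "dist (g n y) (f y) \<le> 2 * inverse (Suc k)" using A_near n by simp
          moreover have "dist (g n x) (g n y) < inverse (Suc n)" using that unfolding U_def by simp
          moreover have "inverse (real (Suc n)) \<le> inverse (Suc k)" using n by simp
          ultimately show ?thesis using dist_triangle[of "g n x" "f y" "g n y"]
            unfolding mem_cball by linarith
        qed
        then have "convex hull (f ` {y. x \<in> U n y}) \<subseteq> cball (g n x) (3 * inverse (Suc k))"
          by (intro hull_minimal) auto
        then show ?thesis using G(2)[of n x] k by (auto simp: dist_commute)
      qed
      then show "\<exists>no. \<forall>n\<ge>no. norm (dist (G n x) (g n x) - 0) < e" by blast
    qed
    then have "(\<lambda>n. G n x - g n x) \<longlonglongrightarrow> 0"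
      by (simp add: dist_norm tendsto_norm_zero_iff)
    from tendsto_add[OF this g(2)[of x]] show "(\<lambda>n. G n x) \<longlonglongrightarrow> f x" by simp
  qed
qed

theorem proposition2p4:
  fixes f :: "'a::metric_space \<Rightarrow> 'b::real_normed_vector"
  assumes "baire_one f"
  shows "\<exists>F :: nat \<Rightarrow> 'a \<Rightarrow> 'b.
      (\<forall>n. bounded (range (F n)) \<and> locally_lipschitz (F n)) \<and>
      (\<forall>y. (\<lambda>n. F n y) \<longlonglongrightarrow> f y) \<and>
      UCPC F f \<and>
      (\<forall>(a::'a) (r::ereal). 0 < r \<and> bounded (f ` eball a (2 * r)) \<longrightarrow>
         uniformly_bounded_on (eball a r) F)"
proof -
  obtain G where G: "\<And>n. locally_lipschitz (G n)" "\<And>y. (\<lambda>n. G n y) \<longlonglongrightarrow> f y"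
    "\<And>n y. G n y \<in> convex hull (f ` ball y (inverse (Suc n)))"
    using baire_one_hull_approximation[OF assms] by blast
  \<comment> \<open>Radial truncation by a cutoff in the target space, at height \<open>n\<close> with a margin of \<open>1\<close>. Its factor
    lies in \<open>[0, 1]\<close>, so it never increases the norm.\<close>
  have "\<exists>\<tau> :: 'b \<Rightarrow> real. locally_lipschitz \<tau> \<and> (\<forall>z. 0 \<le> \<tau> z \<and> \<tau> z \<le> 1) \<and>
      (\<forall>z. norm z \<le> real n \<longrightarrow> \<tau> z = 1) \<and> (\<forall>z. \<tau> z \<noteq> 0 \<longrightarrow> norm z \<le> real n + 1)"
      (is "\<exists>\<tau>. ?cutoff n \<tau>") for n
  proof -
    obtain \<tau> :: "'b \<Rightarrow> real" where \<tau>: "locally_lipschitz \<tau>" "\<And>x. 0 \<le> \<tau> x" "\<And>x. \<tau> x \<le> 1"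
      "\<And>x e. e \<in> cball 0 (real n) \<Longrightarrow> dist x e < 1 / 2 \<Longrightarrow> \<tau> x = 1"
      "\<And>x. \<tau> x \<noteq> 0 \<Longrightarrow> \<exists>e\<in>cball 0 (real n). dist x e < 1"
      using lipschitz_cutoff[of 1 "cball (0::'b) (real n)"] by auto
    have "norm z \<le> real n + 1" if nz: "\<tau> z \<noteq> 0" for z
    proof -
      obtain e where "norm e \<le> real n" "norm (z - e) < 1"
        using \<tau>(5)[OF nz] by (auto simp: dist_norm)
      then show ?thesis using norm_triangle_ineq2[of z e] by linarith
    qed
    moreover have "\<tau> z = 1" if "norm z \<le> real n" for z
      using \<tau>(4)[of z z] that by simp
    ultimately show ?thesis using \<tau>(1-3) by blast
  qed
  then obtain \<tau> where cutoff: "\<And>n. ?cutoff n (\<tau> n)"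
    by metis
  have \<tau>: "locally_lipschitz (\<tau> n)" "0 \<le> \<tau> n z" "\<tau> n z \<le> 1"
      "norm z \<le> real n \<Longrightarrow> \<tau> n z = 1" "\<tau> n z \<noteq> 0 \<Longrightarrow> norm z \<le> real n + 1" for n z
    using cutoff[of n] by blast+
  define F where "F n y = \<tau> n (G n y) *\<^sub>R G n y" for n y
  have F_le_G: "norm (F n y) \<le> norm (G n y)" for n y
    using \<tau>(2,3)[of n "G n y"] by (simp add: F_def mult_left_le_one_le)
  have F_bound: "norm (F n y) \<le> real n + 1" for n y
    using F_le_G[of n y] \<tau>(5)[of n "G n y"] by (cases "\<tau> n (G n y) = 0") (auto simp: F_def)
  have F_eq_G: "F n y = G n y" if "norm (G n y) \<le> real n" for n y
    using \<tau>(4)[OF that] by (simp add: F_def)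
  have G_in: "G n y \<in> K" if "convex K" "\<And>z. dist y z < inverse (Suc n) \<Longrightarrow> f z \<in> K" for n y K
  proof -
    have "convex hull (f ` ball y (inverse (Suc n))) \<subseteq> K"
      by (rule hull_minimal) (use that in auto)
    then show ?thesis using G(3) by blast
  qed
  have F_ucpc: "UCPC F f"
    unfolding UCPC_def
  proof (intro allI impI)
    fix y0 and \<epsilon> :: real
    assume "isCont f y0" and e: "\<epsilon> > 0"
    then obtain d where d: "d > 0" "\<And>z. dist z y0 < d \<Longrightarrow> dist (f z) (f y0) < \<epsilon> / 2"
      unfolding continuous_at_eps_delta by (metis half_gt_zero)
    obtain N where N: "inverse (real (Suc N)) < d / 2"
      using reals_Archimedean[of "d / 2"] d(1) by auto
    obtain M :: nat where M: "norm (f y0) + \<epsilon> \<le> real M" using real_arch_simple by blast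
    have "norm (F k y - f y0) < \<epsilon>" if k: "k \<ge> max M N" and y: "y \<in> ball y0 (d / 2)" for k y
    proof -
      have "inverse (real (Suc k)) \<le> inverse (real (Suc N))" using k by simp
      then have "G k y \<in> cball (f y0) (\<epsilon> / 2)"
      proof (intro G_in convex_cball)
        fix z assume "dist y z < inverse (Suc k)"
        then have "dist z y0 < d"
          using y N \<open>inverse (real (Suc k)) \<le> _\<close> dist_triangle[of z y0 y]
          unfolding mem_ball dist_commute[of _ y0] dist_commute[of z] by linarith
        then show "f z \<in> cball (f y0) (\<epsilon> / 2)" using d(2)[of z] by (simp add: dist_commute)
      qed
      then have near: "norm (G k y - f y0) \<le> \<epsilon> / 2" by (simp add: dist_norm norm_minus_commute)
      then have "norm (G k y) \<le> real k"
        using M k e norm_triangle_ineq2[of "G k y" "f y0"] by simp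
      then show ?thesis using F_eq_G near e by simp
    qed
    then show "\<exists>k0 U. open U \<and> y0 \<in> U \<and> (\<forall>k\<ge>k0. \<forall>y\<in>U. norm (F k y - f y0) < \<epsilon>)"
      using d(1) by (intro exI[of _ "max M N"] exI[of _ "ball y0 (d / 2)"]) auto
  qed
  have F_lim: "(\<lambda>n. F n y) \<longlonglongrightarrow> f y" for y
  proof -
    obtain B where B: "\<And>n. norm (G n y) \<le> B"
      using convergent_imp_bounded[OF G(2)[of y]] by (auto simp: bounded_iff)
    obtain M :: nat where "B \<le> real M" using real_arch_simple by blast
    then have "F n y = G n y" if "n \<ge> M" for n
      using that B[of n] by (intro F_eq_G) linarith
    then have "eventually (\<lambda>n. G n y = F n y) sequentially"
      unfolding eventually_sequentially by metis
    then show ?thesis using G(2)[of y] by (rule Lim_transform_eventually[rotated])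
  qed
  have F_unif: "uniformly_bounded_on (eball a r) F"
    if r: "0 < r" and bd: "bounded (f ` eball a (2 * r))" for a and r :: ereal
  proof -
    obtain M where M: "\<And>z. z \<in> eball a (2 * r) \<Longrightarrow> norm (f z) \<le> M"
      using bd unfolding bounded_iff by blast
    obtain s :: real where s: "0 < s" "ereal s \<le> r"
      using r by (cases r) (auto intro: that[of 1])
    obtain N where N: "inverse (real (Suc N)) < s"
      using reals_Archimedean[OF s(1)] by auto
    \<comment> \<open>For \<open>n < N\<close> the ball around \<open>y\<close> may leave \<^term>\<open>eball a (2 * r)\<close>; there the truncation
      height is the bound.\<close>
    have "norm (F n y) \<le> max M (real N + 1)" if y: "y \<in> eball a r" for n y
    proof (cases "n < N")
      case True
      then show ?thesis using F_bound[of n y] by linarith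
    next
      case False
      have "G n y \<in> cball 0 M"
      proof (intro G_in convex_cball)
        fix z assume "dist y z < inverse (Suc n)"
        moreover have "inverse (real (Suc n)) \<le> inverse (real (Suc N))" using False by simp
        ultimately have "dist a z < dist a y + s"
          using N dist_triangle[of a z y] by linarith
        then have "z \<in> eball a (2 * r)"
          using y s(2) by (cases r) auto
        then show "f z \<in> cball 0 M" using M by simp
      qed
      then show ?thesis using F_le_G[of n y] by simp
    qed
    then have "(SUP n. SUP y\<in>eball a r. ereal (norm (F n y))) \<le> ereal (max M (real N + 1))"
      by (intro SUP_least) (simp only: ereal_less_eq)
    then show ?thesis
      unfolding uniformly_bounded_on_def by (rule le_less_trans) (simp only: less_ereal.simps(4))
  qed
  have "bounded (range (F n))" for n
    using F_bound by (auto intro!: boundedI)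
  moreover have "locally_lipschitz (F n)" for n
    unfolding F_def by (rule locally_lipschitz_scaleR[OF locally_lipschitz_compose[OF \<tau>(1) G(1)] G(1)])
  ultimately show ?thesis
    using F_lim F_ucpc F_unif by blast
qed

end
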